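(* Let $j\in\{2,\dots,J\}$, $i\in\{1,\dots,m_j\}$, and let $\Omega_i^{(j)}=\bigcup_{\ell=1}^{N_i}\Omega_{k_\ell}^{(j-1)}$ in a refinement chain. Let $\{\bm\lambda_{k_\ell}^{(j-1)}\}_{\ell=1}^{N_i}$ be a collection of points such that $\bm\lambda_{k_\ell}^{(j-1)}\in\Lambda_{k_\ell}^{(j-1)}$ for all $\ell=1,\dots,N_i$. Then $$\sum_{\ell=1}^{N_i}\pi_{k_\ell,i}^{(j-1,j)}\bm\lambda_{k_\ell}^{(j-1)}$$ belongs to $\Lambda_i^{(j)}$.
   Context: Scenarios $\Omega=\{\bm\omega^1,\dots,\bm\omega^{|\mathcal S|}\}$, $\mathcal S=\{1,\dots,|\mathcal S|\}$, with probability measure $\mathbb P$, $p^s=\mathbb P(\bm\omega^s)$; $\bm W\in\mathbb R^{p\times m}$ and $\bm q^s\in\mathbb R^m$, $s\in\mathcal S$, are given. Refinement chain. For each level $j=1,\dots,J$ there is a collection $\{\Omega_i^{(j)}\}_{i=1}^{m_j}$ of subsets of $\Omega$, with $m_J=1$, $\Omega_1^{(J)}=\Omega$, such that (R1) $\Omega=\bigcup_i\Omega_i^{(j)}$ for each $j$; (R2) for $j\ge2$ each $\Omega_i^{(j)}$ is a union $\bigcup_{\ell=1}^{N_i}\Omega_{k_\ell}^{(j-1)}$ of sets of level $j-1$. Each $\Omega_i^{(j)}$ carries a probability measure $\mathbb P_i^{(j)}$ (with $\mathbb P_1^{(J)}=\mathbb P$) such that (P1) $\mathbb P_i^{(j)}$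 has support $\Omega_i^{(j)}$; (P2) $\mathbb P=\sum_{i}\pi_i^{(j)}\mathbb P_i^{(j)}$ with intra-level weights $\pi_i^{(j)}\ge0$, $\sum_i\pi_i^{(j)}=1$; (P3) for $j\ge2$, $\mathbb P_i^{(j)}=\sum_{\ell=1}^{N_i}\pi_{k_\ell,i}^{(j-1,j)}\mathbb P_{k_\ell}^{(j-1)}$ with inter-level weights $\pi_{k_\ell,i}^{(j-1,j)}\ge0$, $\sum_\ell\pi_{k_\ell,i}^{(j-1,j)}=1$. Write $p^s_{\Omega_i^{(j)}}:=\mathbb P_i^{(j)}(\bm\omega^s)$ (zero if $\bm\omega^s\notin\Omega_i^{(j)}$). Dual feasible regions. $\Lambda_i^{(j)}=\prod_{s:\bm\omega^s\in\Omega_i^{(j)}}\{\bm\lambda^s\in\mathbb R^p:\bm W^\top\bm\lambda^s\le p^s_{\Omega_i^{(j)}}\bm q^s\}\subseteq\mathbb R^{p|\Omega_i^{(j)}|}$. When $\Omega_{k_\ell}^{(j-1)}\subseteq\Omega_i^{(j)}$, points of $\Lambda_{k_\ell}^{(j-1)}$ are regarded as vectors of $\mathbb R^{p|\Omega_i^{(j)}|}$ by setting to zero all components corresponding to scenarios of $\Omega_i^{(j)}$ not in $\Omega_{k_\ell}^{(j-1)}$. *)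

theory Defs
  imports "HOL-Probability.Probability"
begin

text \<open>
  Scenario \<open>s \<in> {1..S}\<close> is \<open>\<omega> s\<close>. The set and the measure number \<open>i \<in> {1..m j}\<close> of level \<open>j\<close> are
  \<open>\<Omega> j i\<close> and \<open>\<P> j i\<close>, with intra-level weight \<open>\<pi> j i\<close>. The set \<open>\<Omega> j i\<close> decomposes into the
  sets \<open>\<Omega> (j - 1) (k j i l)\<close> for \<open>l \<in> {1..N j i}\<close>, and \<open>\<rho> j k' i\<close> is the inter-level weight
  between the set \<open>k'\<close> of level \<open>j - 1\<close> and the set \<open>i\<close> of level \<open>j\<close>.
  The indices \<open>k j i l\<close>, for \<open>l \<in> {1..N j i}\<close>, are not required to be distinct.
\<close>

locale refinement_chain =
  fixes S :: nat
    and \<omega> :: "nat \<Rightarrow> 'w"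
    and \<P>\<^sub>0 :: "'w pmf"
    and J :: nat
    and m :: "nat \<Rightarrow> nat"
    and \<Omega> :: "nat \<Rightarrow> nat \<Rightarrow> 'w set"
    and \<P> :: "nat \<Rightarrow> nat \<Rightarrow> 'w pmf"
    and \<pi> :: "nat \<Rightarrow> nat \<Rightarrow> real"
    and N :: "nat \<Rightarrow> nat \<Rightarrow> nat"
    and k :: "nat \<Rightarrow> nat \<Rightarrow> nat \<Rightarrow> nat"
    and \<rho> :: "nat \<Rightarrow> nat \<Rightarrow> nat \<Rightarrow> real"
  assumes scenarios_distinct: "inj_on \<omega> {1..S}"
    and levels: "J \<ge> 1"
    and subsets: "\<And>j i. j \<in> {1..J} \<Longrightarrow> i \<in> {1..m j} \<Longrightarrow> \<Omega> j i \<subseteq> \<omega> ` {1..S}"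
    and top_card: "m J = 1"
    and top_set: "\<Omega> J 1 = \<omega> ` {1..S}"
    and top_measure: "\<P> J 1 = \<P>\<^sub>0"
    and R1: "\<And>j. j \<in> {1..J} \<Longrightarrow> \<omega> ` {1..S} = (\<Union>i\<in>{1..m j}. \<Omega> j i)"
    and R2_index: "\<And>j i l. j \<in> {2..J} \<Longrightarrow> i \<in> {1..m j} \<Longrightarrow> l \<in> {1..N j i} \<Longrightarrow>
          k j i l \<in> {1..m (j - 1)}"
    and R2: "\<And>j i. j \<in> {2..J} \<Longrightarrow> i \<in> {1..m j} \<Longrightarrow>
          \<Omega> j i = (\<Union>l\<in>{1..N j i}. \<Omega> (j - 1) (k j i l))"
    and P1: "\<And>j i. j \<in> {1..J} \<Longrightarrow> i \<in> {1..m j} \<Longrightarrow> set_pmf (\<P> j i) = \<Omega> j i"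
    and P2_nonneg: "\<And>j i. j \<in> {1..J} \<Longrightarrow> i \<in> {1..m j} \<Longrightarrow> \<pi> j i \<ge> 0"
    and P2_sum: "\<And>j. j \<in> {1..J} \<Longrightarrow> (\<Sum>i\<in>{1..m j}. \<pi> j i) = 1"
    and P2: "\<And>j A. j \<in> {1..J} \<Longrightarrow>
          measure_pmf.prob \<P>\<^sub>0 A = (\<Sum>i\<in>{1..m j}. \<pi> j i * measure_pmf.prob (\<P> j i) A)"
    and P3_nonneg: "\<And>j i l. j \<in> {2..J} \<Longrightarrow> i \<in> {1..m j} \<Longrightarrow> l \<in> {1..N j i} \<Longrightarrow>
          \<rho> j (k j i l) i \<ge> 0"
    and P3_sum: "\<And>j i. j \<in> {2..J} \<Longrightarrow> i \<in> {1..m j} \<Longrightarrow> (\<Sum>l\<in>{1..N j i}. \<rho> j (k j i l) i) = 1"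
    and P3: "\<And>j i A. j \<in> {2..J} \<Longrightarrow> i \<in> {1..m j} \<Longrightarrow>
          measure_pmf.prob (\<P> j i) A =
            (\<Sum>l\<in>{1..N j i}. \<rho> j (k j i l) i * measure_pmf.prob (\<P> (j - 1) (k j i l)) A)"

definition scen_idx :: "nat \<Rightarrow> (nat \<Rightarrow> 'w) \<Rightarrow> 'w set \<Rightarrow> nat set" where
  "scen_idx S \<omega> A = {s \<in> {1..S}. \<omega> s \<in> A}"

text \<open>
  A point of \<open>\<real>\<^bsup>p|A|\<^esup>\<close> is a family of vectors of \<open>\<real>\<^bsup>p\<^esup>\<close> indexed by \<open>scen_idx S \<omega> A\<close>,
  extensional outside of it. The order on \<^typ>\<open>real ^ 'm\<close> is componentwise.
\<close>

definition dual_region ::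
  "real ^ 'm ^ 'p \<Rightarrow> (nat \<Rightarrow> real ^ 'm) \<Rightarrow> nat \<Rightarrow> (nat \<Rightarrow> 'w) \<Rightarrow> 'w set \<Rightarrow> 'w pmf \<Rightarrow>
    (nat \<Rightarrow> real ^ 'p) set" where
  "dual_region W q S \<omega> A P =
    (\<Pi>\<^sub>E s\<in>scen_idx S \<omega> A. {v. transpose W *v v \<le> pmf P (\<omega> s) *\<^sub>R q s})"

definition zero_extend :: "nat set \<Rightarrow> nat set \<Rightarrow> (nat \<Rightarrow> 'v::zero) \<Rightarrow> nat \<Rightarrow> 'v" where
  "zero_extend I I' v = (\<lambda>s\<in>I'. if s \<in> I then v s else 0)"

end

theory Submission
  imports Defs
begin

text \<open>\<open>dual_region\<close> is a product over scenarios, so it suffices to fix a scenario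
  s. There the constraint is linear in the vector, with a right-hand side proportional to the mass
  of s. Each zero-extended point satisfies the constraint of its own measure at s; averaging these
  with the nonnegative weights \<open>\<rho>\<close> preserves the inequality, and \<open>P3\<close>
  says that the averaged mass is exactly that of \<open>\<P> j i\<close>.\<close>

theorem lemma3p2:
  fixes W :: "real ^ 'm ^ 'p"
    and q :: "nat \<Rightarrow> real ^ 'm"
    and \<omega> :: "nat \<Rightarrow> 'w"
    and lam :: "nat \<Rightarrow> nat \<Rightarrow> real ^ 'p"
  assumes "refinement_chain S \<omega> \<P>\<^sub>0 J m \<Omega> \<P> \<pi> N k \<rho>"
    and "j \<in> {2..J}"
    and "i \<in> {1..m j}"
    and "\<And>l. l \<in> {1..N j i} \<Longrightarrow>
      lam l \<in> dual_region W q S \<omega> (\<Omega> (j - 1) (k j i l)) (\<P> (j - 1) (k j i l))"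
  shows "(\<lambda>s\<in>scen_idx S \<omega> (\<Omega> j i). \<Sum>l\<in>{1..N j i}. \<rho> j (k j i l) i *\<^sub>R
            zero_extend (scen_idx S \<omega> (\<Omega> (j - 1) (k j i l))) (scen_idx S \<omega> (\<Omega> j i)) (lam l) s)
         \<in> dual_region W q S \<omega> (\<Omega> j i) (\<P> j i)"
proof -
  interpret refinement_chain S \<omega> \<P>\<^sub>0 J m \<Omega> \<P> \<pi> N k \<rho> by fact
  define I where "I l = scen_idx S \<omega> (\<Omega> (j - 1) (k j i l))" for l
  define x where "x l s = zero_extend (I l) (scen_idx S \<omega> (\<Omega> j i)) (lam l) s" for l s
  have "transpose W *v (\<Sum>l\<in>{1..N j i}. \<rho> j (k j i l) i *\<^sub>R x l s) \<le> pmf (\<P> j i) (\<omega> s) *\<^sub>R q s"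
    if s: "s \<in> scen_idx S \<omega> (\<Omega> j i)" for s
  proof -
    have x_le: "transpose W *v x l s \<le> pmf (\<P> (j - 1) (k j i l)) (\<omega> s) *\<^sub>R q s"
      if l: "l \<in> {1..N j i}" for l
    proof (cases "s \<in> I l")
      case True
      then show ?thesis
        using assms(4)[OF l] s by (auto simp: dual_region_def I_def x_def zero_extend_def)
    next
      case False
      \<comment> \<open>The padded component is 0, and \<open>q s\<close> may have entries of any
        sign, so the right-hand side must vanish too. It does by \<open>P1\<close>: s lies outside
        the support.\<close>
      have "set_pmf (\<P> (j - 1) (k j i l)) = \<Omega> (j - 1) (k j i l)"
        using assms(2) R2_index[OF assms(2,3) l] by (intro P1) auto
      with False s have "pmf (\<P> (j - 1) (k j i l)) (\<omega> s) = 0"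
        by (auto simp: I_def scen_idx_def set_pmf_iff)
      with False s show ?thesis by (simp add: x_def zero_extend_def)
    qed
    have "transpose W *v (\<Sum>l\<in>{1..N j i}. \<rho> j (k j i l) i *\<^sub>R x l s) =
        (\<Sum>l\<in>{1..N j i}. \<rho> j (k j i l) i *\<^sub>R (transpose W *v x l s))"
      \<comment> \<open>The deleted simp rule would turn \<open>transpose W *v v\<close> into
        \<open>v v* W\<close>, hiding the form to which linearity applies.\<close>
      by (simp add: linear_sum[OF matrix_vector_mul_linear] matrix_vector_mult_scaleR
          del: transpose_matrix_vector)
    also have "\<dots> \<le> (\<Sum>l\<in>{1..N j i}.
        \<rho> j (k j i l) i *\<^sub>R (pmf (\<P> (j - 1) (k j i l)) (\<omega> s) *\<^sub>R q s))"
      using P3_nonneg[OF assms(2,3)] x_le by (intro sum_mono scaleR_left_mono) auto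
    \<comment> \<open>\<open>P3\<close> at a singleton is the mixture identity for point masses; the
      common vector \<open>q s\<close> factors out of the sum.\<close>
    also have "\<dots> = pmf (\<P> j i) (\<omega> s) *\<^sub>R q s"
      using P3[OF assms(2,3), of "{\<omega> s}"] by (simp add: measure_pmf_single scaleR_sum_left)
    finally show ?thesis .
  qed
  then show ?thesis
    by (simp add: dual_region_def x_def I_def)
qed

end
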